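(* For every integer $n\ge 3$, $|B_n(312,321)|=3\cdot 2^{n-3}$.
   Context: A permutation $\sigma\in S_n$ is written as $\sigma(1)\cdots\sigma(n)$. An index $i\in[n-1]$ is an ascent if $\sigma(i)<\sigma(i+1)$ and a descent if $\sigma(i)>\sigma(i+1)$. A ballot permutation is a permutation such that every prefix $\sigma(1)\cdots\sigma(p)$ has at least as many ascents as descents. $\sigma$ contains a pattern $\pi\in S_k$ if some subsequence $\sigma(c_1)\cdots\sigma(c_k)$ with $c_1<\dots<c_k$ is order-isomorphic to $\pi$, and avoids $\pi$ otherwise. $B_n(\pi_1,\dots,\pi_m)$ denotes the set of ballot permutations of length $n$ avoiding all of $\pi_1,\dots,\pi_m$. *)

theory Defs
  imports "HOL-Combinatorics.Multiset_Permutations" "HOL-Library.Sublist"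
begin

text \<open>
  A permutation \<open>\<sigma> \<in> S\<^sub>n\<close> is represented by its one-line word \<open>\<sigma>(1) \<dots> \<sigma>(n)\<close>, that is, by a
  distinct list with set \<open>{1..n}\<close>.  As list positions start at 0, the index \<open>i\<close> below stands for
  the index \<open>i + 1\<close> of \<open>\<sigma>\<close>.
\<close>

abbreviation perms :: "nat \<Rightarrow> nat list set" where
  "perms n \<equiv> permutations_of_set {1..n}"

definition ascents :: "nat list \<Rightarrow> nat set" where
  "ascents w = {i. Suc i < length w \<and> w ! i < w ! Suc i}"

definition descents :: "nat list \<Rightarrow> nat set" where
  "descents w = {i. Suc i < length w \<and> w ! i > w ! Suc i}"

definition ballot :: "nat list \<Rightarrow> bool" where
  "ballot w \<longleftrightarrow> (\<forall>p \<le> length w. card (ascents (take p w)) \<ge> card (descents (take p w)))"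

definition order_isomorphic :: "nat list \<Rightarrow> nat list \<Rightarrow> bool" where
  "order_isomorphic u v \<longleftrightarrow>
     length u = length v \<and> (\<forall>i < length v. \<forall>j < length v. u ! i < u ! j \<longleftrightarrow> v ! i < v ! j)"

text \<open>\<^const>\<open>subseq\<close> is the library's notion of a (not necessarily contiguous) subsequence.\<close>

definition contains_pattern :: "nat list \<Rightarrow> nat list \<Rightarrow> bool" where
  "contains_pattern w \<pi> \<longleftrightarrow> (\<exists>u. subseq u w \<and> order_isomorphic u \<pi>)"

definition avoids :: "nat list \<Rightarrow> nat list \<Rightarrow> bool" where
  "avoids w \<pi> \<longleftrightarrow> \<not> contains_pattern w \<pi>"

definition ballot_avoiders :: "nat \<Rightarrow> nat list set \<Rightarrow> nat list set" where
  "ballot_avoiders n P = {w \<in> perms n. ballot w \<and> (\<forall>\<pi> \<in> P. avoids w \<pi>)}"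

end

theory Submission
  imports Defs
begin

text \<open>
  A word avoids \<open>312\<close> and \<open>321\<close> iff every letter is followed by at most one smaller letter.  The
  first letter is then the least or the second least one, which gives \<open>2\<^bsup>n-1\<^esup>\<close> avoiders.  An avoider
  has no two consecutive descents, so each descent other than one in first position is preceded
  by an ascent; hence an avoider is ballot iff it does not begin with a descent.  Those that do
  begin with a descent begin with \<open>21\<close>, and there are \<open>2\<^bsup>n-3\<^esup>\<close> of them.
\<close>

section \<open>Avoidance as a condition on smaller later letters\<close>

primrec at_most_one_smaller_later :: "nat list \<Rightarrow> bool" where
  "at_most_one_smaller_later [] \<longleftrightarrow> True"
| "at_most_one_smaller_later (a # w) \<longleftrightarrow> at_most_one_smaller_later w \<and>
     (\<forall>y\<in>set w. \<forall>z\<in>set w. y < a \<longrightarrow> z < a \<longrightarrow> y = z)"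

lemma subseq_pair_total:
  assumes "y \<in> set w" "z \<in> set w" "y \<noteq> z"
  shows "subseq [y, z] w \<or> subseq [z, y] w"
  using assms by (induction w) (auto simp: subseq_singleton_left)

lemma subseq_pair_set:
  assumes "subseq [y, z] w"
  shows "y \<in> set w" "z \<in> set w"
  using assms by (auto elim: list_emb_set)

text \<open>A triple in \<open>a # w\<close> either lies in \<open>w\<close> or starts with the head
  \<open>a\<close>. In the second case the order of the other two letters is irrelevant: two
  distinct letters of \<open>w\<close> form a subsequence in one order or the other, and the
  condition is symmetric in \<open>y\<close> and \<open>z\<close>.\<close>

lemma at_most_one_smaller_later_iff:
  "at_most_one_smaller_later w \<longleftrightarrow>
     \<not> (\<exists>x y z. subseq [x, y, z] w \<and> y < x \<and> z < x \<and> y \<noteq> z)"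
proof (induction w)
  case Nil
  then show ?case by simp
next
  case (Cons a w)
  have "(\<exists>x y z. subseq [x, y, z] (a # w) \<and> y < x \<and> z < x \<and> y \<noteq> z) \<longleftrightarrow>
        (\<exists>x y z. subseq [x, y, z] w \<and> y < x \<and> z < x \<and> y \<noteq> z) \<or>
        (\<exists>y z. subseq [y, z] w \<and> y < a \<and> z < a \<and> y \<noteq> z)"
    by (auto simp: list_emb.simps[of _ _ "a # w"])
  moreover have "(\<exists>y z. subseq [y, z] w \<and> y < a \<and> z < a \<and> y \<noteq> z) \<longleftrightarrow>
        \<not> (\<forall>y\<in>set w. \<forall>z\<in>set w. y < a \<longrightarrow> z < a \<longrightarrow> y = z)"
    by (metis subseq_pair_set subseq_pair_total)
  ultimately show ?case using Cons.IH by simp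
qed

lemma all_less_3: "(\<forall>i < Suc (Suc (Suc 0)). P i) \<longleftrightarrow> P 0 \<and> P (Suc 0) \<and> P (Suc (Suc 0))"
  by (simp add: All_less_Suc2)

lemma order_isomorphic_312:
  "order_isomorphic u [3, 1, 2] \<longleftrightarrow> (\<exists>x y z. u = [x, y, z] \<and> y < z \<and> z < x)"
proof
  assume u: "order_isomorphic u [3, 1, 2]"
  then obtain x y z where "u = [x, y, z]"
    by (auto simp: order_isomorphic_def length_Suc_conv numeral_3_eq_3)
  with u show "\<exists>x y z. u = [x, y, z] \<and> y < z \<and> z < x"
    by (simp add: order_isomorphic_def all_less_3)
next
  assume "\<exists>x y z. u = [x, y, z] \<and> y < z \<and> z < x"
  then obtain x y z where "u = [x, y, z]" "y < z" "z < x" by blast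
  then show "order_isomorphic u [3, 1, 2]"
    by (simp add: order_isomorphic_def all_less_3)
qed

lemma order_isomorphic_321:
  "order_isomorphic u [3, 2, 1] \<longleftrightarrow> (\<exists>x y z. u = [x, y, z] \<and> z < y \<and> y < x)"
proof
  assume u: "order_isomorphic u [3, 2, 1]"
  then obtain x y z where "u = [x, y, z]"
    by (auto simp: order_isomorphic_def length_Suc_conv numeral_3_eq_3)
  with u show "\<exists>x y z. u = [x, y, z] \<and> z < y \<and> y < x"
    by (simp add: order_isomorphic_def all_less_3)
next
  assume "\<exists>x y z. u = [x, y, z] \<and> z < y \<and> y < x"
  then obtain x y z where "u = [x, y, z]" "z < y" "y < x" by blast
  then show "order_isomorphic u [3, 2, 1]"
    by (simp add: order_isomorphic_def all_less_3)
qed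

text \<open>The patterns 312 and 321 are the two ways to order two distinct letters that follow a
  greater one, so excluding both excludes every such triple.\<close>

lemma avoids_312_321_iff:
  "avoids w [3, 1, 2] \<and> avoids w [3, 2, 1] \<longleftrightarrow> at_most_one_smaller_later w"
proof -
  have order: "y < x \<and> z < x \<and> y \<noteq> z \<longleftrightarrow> y < z \<and> z < x \<or> z < y \<and> y < x" for x y z :: nat
    by linarith
  have "contains_pattern w [3, 1, 2] \<longleftrightarrow> (\<exists>x y z. subseq [x, y, z] w \<and> y < z \<and> z < x)"
    unfolding contains_pattern_def order_isomorphic_312 by blast
  moreover have "contains_pattern w [3, 2, 1] \<longleftrightarrow> (\<exists>x y z. subseq [x, y, z] w \<and> z < y \<and> y < x)"
    unfolding contains_pattern_def order_isomorphic_321 by blast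
  ultimately show ?thesis
    unfolding avoids_def at_most_one_smaller_later_iff order by blast
qed

section \<open>The ballot condition on avoiders\<close>

text \<open>Two consecutive descents would put two distinct smaller letters after
  \<open>w ! i\<close>. The conclusion is not strict because letters may repeat here.\<close>

lemma no_double_descent:
  assumes "at_most_one_smaller_later w" "Suc (Suc i) < length w" "w ! i > w ! Suc i"
  shows "w ! Suc i \<le> w ! Suc (Suc i)"
  using assms
proof (induction w arbitrary: i)
  case (Cons a w)
  show ?case
  proof (cases i)
    case 0
    then have "0 < length w" "1 < length w" "w ! 0 < a" using Cons.prems by auto
    then have "w ! 0 \<in> set w" "w ! 1 \<in> set w" "w ! 0 < a" using nth_mem by blast+
    then have "w ! 1 < a \<Longrightarrow> w ! 0 = w ! 1" using Cons.prems(1) by simp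
    with \<open>w ! 0 < a\<close> 0 show ?thesis by (cases "w ! 1 < a") auto
  qed (use Cons in auto)
qed simp

lemma ballot_iff:
  assumes "at_most_one_smaller_later w" "distinct w"
  shows "ballot w \<longleftrightarrow> 0 \<notin> descents w"
proof
  assume b: "ballot w"
  show "0 \<notin> descents w"
  proof
    assume "0 \<in> descents w"
    then have l: "2 \<le> length w" and "w ! 1 < w ! 0" by (auto simp: descents_def)
    \<comment> \<open>The prefix of length 2 already violates the ballot condition.\<close>
    then have "ascents (take 2 w) = {}" "0 \<in> descents (take 2 w)"
      by (auto simp: ascents_def descents_def)
    moreover have "finite (descents (take 2 w))"
      by (rule finite_subset[of _ "{..<2}"]) (auto simp: descents_def)
    ultimately have "card (descents (take 2 w)) > card (ascents (take 2 w))"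
      by (auto simp: card_gt_0_iff)
    with b l show False unfolding ballot_def by (meson leD)
  qed
next
  assume 0: "0 \<notin> descents w"
  show "ballot w"
    unfolding ballot_def
  proof (intro allI impI)
    fix p assume p: "p \<le> length w"
    \<comment> \<open>The map from \<open>i\<close> to \<open>i - 1\<close> will inject the descents
      of the prefix into its ascents. Positivity makes the truncated difference a true
      predecessor.\<close>
    have pos: "i > 0" if "i \<in> descents (take p w)" for i
      using that 0 p by (cases i) (auto simp: descents_def)
    have "i - 1 \<in> ascents (take p w)" if i: "i \<in> descents (take p w)" for i
    proof -
      obtain j where j: "i = Suc j" using pos[OF i] gr0_implies_Suc by blast
      have "Suc (Suc j) < p" "w ! Suc j > w ! Suc (Suc j)"
        using i j p by (auto simp: descents_def)
      moreover from this have "w ! j \<le> w ! Suc j"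
        using no_double_descent[OF assms(1), of j] p by (meson leD leI less_le_trans)
      moreover have "w ! j \<noteq> w ! Suc j"
        using assms(2) p \<open>Suc (Suc j) < p\<close> by (simp add: nth_eq_iff_index_eq)
      ultimately show ?thesis using j p by (simp add: ascents_def)
    qed
    then have "(\<lambda>i. i - 1) ` descents (take p w) \<subseteq> ascents (take p w)" by auto
    moreover have "inj_on (\<lambda>i. i - 1) (descents (take p w))"
      using pos by (intro inj_onI) (metis Suc_pred')
    moreover have "finite (ascents (take p w))"
      by (rule finite_subset[of _ "{..<p}"]) (auto simp: ascents_def)
    ultimately show "card (descents (take p w)) \<le> card (ascents (take p w))"
      by (metis card_inj_on_le)
  qed
qed

section \<open>Counting avoiders by their first letter\<close>

text \<open>Arbitrary letter sets are allowed because deleting the first letter of a word on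
  \<open>{1..n}\<close> may leave a gap.\<close>

definition avoiders :: "nat set \<Rightarrow> nat list set" where
  "avoiders S = {w \<in> permutations_of_set S. at_most_one_smaller_later w}"

lemma finite_avoiders: "finite (avoiders S)"
  unfolding avoiders_def by simp

lemma Cons_mem_avoiders_iff:
  "a # w \<in> avoiders S \<longleftrightarrow> a \<in> S \<and> w \<in> avoiders (S - {a}) \<and>
     (\<forall>y\<in>S - {a}. \<forall>z\<in>S - {a}. y < a \<longrightarrow> z < a \<longrightarrow> y = z)"
  by (auto simp: avoiders_def permutations_of_set_def)

lemma two_least:
  fixes S :: "nat set"
  assumes "finite S" "card S \<ge> 2"
  obtains m k T where "S = insert m (insert k T)" "m < k" "\<forall>t\<in>T. k < t"
proof -
  define m where "m = Min S"
  define k where "k = Min (S - {m})"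
  have "S \<noteq> {}" using assms by auto
  then have m: "m \<in> S" "\<And>x. x \<in> S \<Longrightarrow> m \<le> x" using assms by (auto simp: m_def)
  have "card (S - {m}) \<ge> 1" using assms m by simp
  then have "S - {m} \<noteq> {}" by (metis card.empty not_one_le_zero)
  then have "k \<in> S - {m}" using assms unfolding k_def by (intro Min_in) auto
  have k: "k \<le> x" if "x \<in> S - {m}" for x
    using assms that unfolding k_def by (intro Min_le) auto
  show thesis
  proof
    show "S = insert m (insert k (S - {m, k}))" using m \<open>k \<in> S - {m}\<close> by auto
    show "m < k" using m \<open>k \<in> S - {m}\<close> by (simp add: order_less_le)
    show "\<forall>t\<in>S - {m, k}. k < t" using k by (simp add: order_less_le)
  qed
qed

text \<open>A first letter from \<open>T\<close> would be followed by both smaller letters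
  \<open>m\<close> and \<open>k\<close>. A first letter \<open>m\<close> has no smaller letter after
  it, and \<open>k\<close> has only \<open>m\<close>.\<close>

lemma Cons_mem_avoiders_two_least:
  assumes S: "S = insert m (insert k T)" and mk: "m < k" "\<forall>t\<in>T. k < t"
  shows "a # w \<in> avoiders S \<longleftrightarrow>
    a = m \<and> w \<in> avoiders (insert k T) \<or> a = k \<and> w \<in> avoiders (insert m T)"
proof -
  have T: "m \<notin> T" "k \<notin> T" using assms by (meson less_trans less_irrefl)+
  have del: "S - {m} = insert k T" "S - {k} = insert m T" using assms T by auto
  have head: "a \<in> S \<and> (\<forall>y\<in>S - {a}. \<forall>z\<in>S - {a}. y < a \<longrightarrow> z < a \<longrightarrow> y = z) \<longleftrightarrow> a = m \<or> a = k"
    (is "?L \<longleftrightarrow> ?R")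
  proof
    assume a: ?L
    show ?R
    proof (rule ccontr)
      assume "\<not> ?R"
      moreover have "a \<in> S" using a by (rule conjunct1)
      ultimately have "a \<in> T" using S by blast
      then have "k < a" using mk(2) by blast
      moreover from this have "m < a" using mk(1) by linarith
      moreover have "m \<in> S - {a}" "k \<in> S - {a}" using S \<open>\<not> ?R\<close> by auto
      ultimately have "m = k" using a by blast
      then show False using mk(1) by simp
    qed
  next
    assume ?R
    moreover have "\<not> t < m" "\<not> t < k" if "t \<in> T" for t
      using bspec[OF mk(2) that] mk(1) by linarith+
    ultimately show ?L using S mk(1) by (elim disjE) auto
  qed
  then show ?thesis
    using del unfolding Cons_mem_avoiders_iff by metis
qed

lemma avoiders_two_least:
  assumes S: "S = insert m (insert k T)" and mk: "m < k" "\<forall>t\<in>T. k < t"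
  shows "avoiders S = (#) m ` avoiders (insert k T) \<union> (#) k ` avoiders (insert m T)"
proof (rule set_eqI)
  fix w
  have "[] \<notin> avoiders S" using S by (auto simp: avoiders_def permutations_of_set_def)
  then show "w \<in> avoiders S \<longleftrightarrow>
      w \<in> (#) m ` avoiders (insert k T) \<union> (#) k ` avoiders (insert m T)"
    using Cons_mem_avoiders_two_least[OF assms] by (cases w) auto
qed

lemma avoiders_small:
  assumes "finite S" "card S \<le> 1"
  shows "card (avoiders S) = 1"
proof -
  consider "S = {}" | a where "S = {a}"
    using assms by (metis card_0_eq card_1_singletonE le_less less_one)
  then show ?thesis
  proof cases
    case 1
    then have "avoiders S = {[]}" by (auto simp: avoiders_def)
    then show ?thesis by simp
  next
    case 2
    then have "avoiders S = {[a]}" by (auto simp: avoiders_def)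
    then show ?thesis by simp
  qed
qed

text \<open>For empty \<open>S\<close> the truncated exponent still gives the correct value 1.\<close>

lemma card_avoiders:
  assumes "finite S"
  shows "card (avoiders S) = 2 ^ (card S - 1)"
  using assms
proof (induction "card S" arbitrary: S rule: less_induct)
  case less
  show ?case
  proof (cases "card S \<le> 1")
    case True
    then show ?thesis using avoiders_small less.prems by simp
  next
    case False
    with less.prems obtain m k T
      where S: "S = insert m (insert k T)" and mk: "m < k" "\<forall>t\<in>T. k < t"
      using two_least by (metis Suc_1 not_less_eq_eq)
    have T: "m \<notin> T" "k \<notin> T" "finite T" using mk S less.prems by (auto dest: less_trans)
    have c: "card S = card T + 2" using T mk S by simp
    \<comment> \<open>Either remaining set has \<open>card T + 1\<close> letters. The two classes
      differ in the first letter, so their sizes add up to \<open>2 ^ (card T + 1)\<close>.\<close>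
    have "card (avoiders (insert k T)) = 2 ^ card T" "card (avoiders (insert m T)) = 2 ^ card T"
      using less.hyps[of "insert k T"] less.hyps[of "insert m T"] T c by auto
    moreover have "(#) m ` avoiders (insert k T) \<inter> (#) k ` avoiders (insert m T) = {}"
      using mk by auto
    ultimately show ?thesis
      unfolding avoiders_two_least[OF S mk] c
      by (simp add: card_Un_disjoint finite_avoiders card_image)
  qed
qed

section \<open>Avoiders that begin with a descent\<close>

text \<open>The first letter is \<open>m\<close> or \<open>k\<close>, and only \<open>k\<close> can
  be followed by a smaller letter, namely \<open>m\<close>. Neither letter then constrains the rest,
  since no letter of \<open>T\<close> is below \<open>k\<close>.\<close>

lemma avoiders_descent_first:
  assumes S: "S = insert m (insert k T)" and mk: "m < k" "\<forall>t\<in>T. k < t"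
  shows "{w \<in> avoiders S. 0 \<in> descents w} = (\<lambda>w. k # m # w) ` avoiders T"
proof -
  have T: "m \<notin> T" "k \<notin> T" using mk by fastforce+
  have least: "a # w \<in> avoiders (insert m T) \<and> a < k \<longleftrightarrow> a = m \<and> w \<in> avoiders T" for a w
  proof (cases "a = m")
    case True
    moreover have "insert m T - {m} = T" using T by blast
    moreover have "\<not> t < m" if "t \<in> T" for t
      using bspec[OF mk(2) that] mk(1) by linarith
    ultimately show ?thesis using mk(1) by (simp add: Cons_mem_avoiders_iff)
  next
    case False
    moreover have "\<not> t < k" if "t \<in> T" for t
      using bspec[OF mk(2) that] by linarith
    ultimately show ?thesis by (auto simp: Cons_mem_avoiders_iff)
  qed
  have first: "a # w \<in> avoiders (insert k T) \<Longrightarrow> m < a" for a w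
  proof -
    assume "a # w \<in> avoiders (insert k T)"
    then have "a = k \<or> a \<in> T" unfolding Cons_mem_avoiders_iff by blast
    then show "m < a" using mk(1) bspec[OF mk(2), of a] by linarith
  qed
  have two: "a # b # u \<in> avoiders S \<and> b < a \<longleftrightarrow> a = k \<and> b = m \<and> u \<in> avoiders T" for a b u
    using first[of b u] least[of b u] mk(1)
    unfolding Cons_mem_avoiders_two_least[OF assms] by (metis less_asym)
  show ?thesis
  proof (rule set_eqI)
    fix w :: "nat list"
    consider "length w \<le> 1" | a b u where "w = a # b # u"
      by (cases w; cases "tl w") auto
    then show "w \<in> {w \<in> avoiders S. 0 \<in> descents w} \<longleftrightarrow> w \<in> (\<lambda>w. k # m # w) ` avoiders T"
    proof cases
      case 1
      then show ?thesis by (auto simp: descents_def)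
    next
      case (2 a b u)
      then have "0 \<in> descents w \<longleftrightarrow> b < a" by (auto simp: descents_def)
      then show ?thesis using two[of a b u] 2 by auto
    qed
  qed
qed

theorem theorem3p14:
  fixes n :: nat
  assumes "n \<ge> 3"
  shows "card (ballot_avoiders n {[3, 1, 2], [3, 2, 1]}) = 3 * 2 ^ (n - 3)"
proof -
  let ?S = "{1..n}"
  let ?D = "{w \<in> avoiders ?S. 0 \<in> descents w}"
  have "ballot_avoiders n {[3, 1, 2], [3, 2, 1]} = avoiders ?S - ?D"
    using avoids_312_321_iff ballot_iff
    by (auto simp: ballot_avoiders_def avoiders_def dest: permutations_of_setD)
  then have *: "card (ballot_avoiders n {[3, 1, 2], [3, 2, 1]}) = card (avoiders ?S) - card ?D"
    by (simp add: card_Diff_subset finite_avoiders)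
  have S: "?S = insert 1 (insert 2 {3..n})" using assms by auto
  have "?D = (\<lambda>w. 2 # 1 # w) ` avoiders {3..n}"
    using S by (rule avoiders_descent_first) auto
  then have "card ?D = card (avoiders {3..n})"
    by (simp add: card_image inj_on_def)
  \<comment> \<open>The set \<open>{3..n}\<close> has \<open>n - 2\<close> letters, at least one, so
    the exponent is \<open>n - 3\<close>.\<close>
  also have "\<dots> = 2 ^ (n - 3)"
    using assms by (simp add: card_avoiders)
  finally have "card ?D = 2 ^ (n - 3)" .
  \<comment> \<open>The total \<open>2 ^ (n - 1)\<close> is written as a multiple of
    \<open>2 ^ (n - 3)\<close>, so that subtracting the words that begin with a descent leaves the
    factor 3.\<close>
  moreover have "card (avoiders ?S) = 4 * 2 ^ (n - 3)"
  proof -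
    have "n - 1 = (n - 3) + 2" using assms by simp
    then show ?thesis by (simp add: card_avoiders power_add)
  qed
  ultimately show ?thesis using * by simp
qed

end
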